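(* There is a function $\varepsilon(k)\to0$ as $k\to\infty$ such that for every $k\ge2$ and every set $U\subseteq\mathbb{R}^d$ of $k$ distinct points with $\min_{p\in U}\|p\|_1=1$, we have $f(U)\le(1+\varepsilon(k))\ln k$.
   Context: Random Thresholds algorithm on a finite set $U\subseteq\mathbb{R}^d$ of distinct points (with a box $[a,b]^d$ containing $U$ and the origin): start with a tree consisting of a root with region $\mathbb{R}^d$; while some leaf region contains two or more points of $U$, pick $i\in[d]$ and $\theta\in[a,b]$ independently and uniformly at random, and split every leaf $u$ whose region $B_u$ contains two points of $U$ separated by $(i,\theta)$ into children with regions $B_u\cap\{x:x_i\le\theta\}$ and $B_u\cap\{x:x_i>\theta\}$. Let $\widehat p$ be the unique point of $U$ in the final leaf region containing the origin, and $f(U)=\mathbb{E}[\|\widehat p\|_1]$. *)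

theory Defs
  imports "HOL-Probability.Probability"
begin

text \<open>Points of R^d are represented as functions nat => real whose coordinates
at indices >= d vanish; the l1 norm only sums coordinates 0..d-1.
A cut is a pair (i, theta) meaning the hyperplane x_i = theta.\<close>

definition l1norm :: "nat \<Rightarrow> (nat \<Rightarrow> real) \<Rightarrow> real" where
  "l1norm d p = (\<Sum>i<d. \<bar>p i\<bar>)"

definition cut_dist :: "nat \<Rightarrow> real \<Rightarrow> real \<Rightarrow> (nat \<times> real) measure" where
  "cut_dist d a b = uniform_count_measure {..<d} \<Otimes>\<^sub>M uniform_measure lborel {a..b}"

definition separates :: "(nat \<Rightarrow> real) set \<Rightarrow> nat \<times> real \<Rightarrow> (nat \<Rightarrow> real) set \<Rightarrow> bool" where
  "separates U c B = (\<exists>p\<in>U \<inter> B. \<exists>q\<in>U \<inter> B. p (fst c) \<le> snd c \<and> snd c < q (fst c))"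

definition split_leaves :: "(nat \<Rightarrow> real) set \<Rightarrow> nat \<times> real \<Rightarrow> (nat \<Rightarrow> real) set set
    \<Rightarrow> (nat \<Rightarrow> real) set set" where
  "split_leaves U c L = (\<Union>B\<in>L. if separates U c B
       then {B \<inter> {x. x (fst c) \<le> snd c}, B \<inter> {x. x (fst c) > snd c}} else {B})"

primrec leaves :: "(nat \<Rightarrow> real) set \<Rightarrow> (nat \<times> real) stream \<Rightarrow> nat \<Rightarrow> (nat \<Rightarrow> real) set set" where
  "leaves U \<omega> 0 = {UNIV}"
| "leaves U \<omega> (Suc n) = split_leaves U (\<omega> !! n) (leaves U \<omega> n)"

definition finished :: "(nat \<Rightarrow> real) set \<Rightarrow> (nat \<Rightarrow> real) set set \<Rightarrow> bool" where
  "finished U L = (\<forall>B\<in>L. card (U \<inter> B) \<le> 1)"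

text \<open>Output p-hat: the unique point of U in the final leaf region containing the origin
(the loop stops at the first n where every leaf has at most one point). On the
(null) event of non-termination we return the origin.\<close>
definition rt_output :: "(nat \<Rightarrow> real) set \<Rightarrow> (nat \<times> real) stream \<Rightarrow> (nat \<Rightarrow> real)" where
  "rt_output U \<omega> =
     (if \<exists>n. finished U (leaves U \<omega> n)
      then (THE p. p \<in> U \<and> (\<exists>B\<in>leaves U \<omega> (LEAST n. finished U (leaves U \<omega> n)).
                                  (\<lambda>_. 0) \<in> B \<and> p \<in> B))
      else (\<lambda>_. 0))"

definition rt_f :: "nat \<Rightarrow> real \<Rightarrow> real \<Rightarrow> (nat \<Rightarrow> real) set \<Rightarrow> real" where
  "rt_f d a b U = (\<integral>\<omega>. l1norm d (rt_output U \<omega>) \<partial>stream_space (cut_dist d a b))"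

end

theory Submission
  imports Defs "HOL-Real_Asymp.Real_Asymp"
begin

text \<open>
Each cut removes from the points still sharing the leaf of the origin those on its far side,
unless that would remove all of them. Let \<open>z\<close> be a closest point, of norm 1. If the output is
\<open>p \<noteq> z\<close>, let \<open>n\<close> be the first step at which \<open>z\<close> is really removed, by a cut \<open>S\<close>. Then \<open>p\<close> is
also the output of the process started from \<open>U - S\<close> and driven by the same sequence with its
\<open>n\<close>-th cut deleted, because the earlier cuts containing \<open>z\<close> had no effect; moreover none of the
first \<open>n\<close> cuts contains \<open>p\<close> but not \<open>z\<close>. The deleted cut is independent of the remaining
sequence, and cuts containing \<open>z\<close> have total probability \<open>1 / w\<close> with \<open>w = d (b - a)\<close>. So summing
over \<open>n\<close> bounds the expected norm of \<open>p\<close> by the largest, over \<open>S\<close>, expectation of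
\<open>\<parallel>q\<parallel> G q / w\<close>, where \<open>q\<close> is the output from \<open>U - S\<close> and \<open>G q\<close> the waiting time for a cut containing
\<open>q\<close> but not \<open>z\<close>. Each \<open>G q\<close> is geometric with parameter at least \<open>(\<parallel>q\<parallel> - 1) / w\<close>, so the maximum
over \<open>k\<close> points costs about \<open>ln k\<close>, whatever the dependence between them. Points of norm at most
\<open>1 + sqrt (ln k)\<close> are set aside; for the others the loss \<open>\<parallel>q\<parallel> / (\<parallel>q\<parallel> - 1)\<close> tends to 1.
\<close>

text \<open>\<open>V\<close> is the set of points of \<open>U\<close> in the leaf of the origin, \<open>S\<close> the set of points that the
cut separates from the origin.\<close>

definition retain :: "'a set \<Rightarrow> 'a set \<Rightarrow> 'a set" where
  "retain V S = (if V \<subseteq> S then V else V - S)"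

text \<open>Expectation of \<open>F xs\<close> when the \<open>n\<close> entries of \<open>xs\<close> are independent with law \<open>m\<close> on \<open>A\<close>.\<close>

primrec wsum :: "'b set \<Rightarrow> ('b \<Rightarrow> real) \<Rightarrow> nat \<Rightarrow> ('b list \<Rightarrow> real) \<Rightarrow> real" where
  "wsum A m 0 F = F []"
| "wsum A m (Suc n) F = (\<Sum>x\<in>A. m x * wsum A m n (\<lambda>xs. F (x # xs)))"

text \<open>The value 0 marks a run that has not yet isolated a point. For nonnegative
  \<open>h\<close> the value along a run therefore only grows with the number of cuts, which later
  permits monotone convergence.\<close>

definition singleton_val :: "('a \<Rightarrow> real) \<Rightarrow> 'a set \<Rightarrow> real" where
  "singleton_val h V = (if is_singleton V then h (the_elem V) else 0)"

lemma singleton_val_singleton [simp]: "singleton_val h {p} = h p"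
  by (simp add: singleton_val_def)

section \<open>Expectations over finite lists of independent entries\<close>

lemma wsum_nonneg:
  assumes "\<And>x. x \<in> A \<Longrightarrow> 0 \<le> m x" "\<And>xs. 0 \<le> F xs"
  shows "0 \<le> wsum A m n F"
  using assms(2) by (induction n arbitrary: F) (auto intro!: sum_nonneg mult_nonneg_nonneg assms(1))

lemma wsum_mono:
  assumes "\<And>x. x \<in> A \<Longrightarrow> 0 \<le> m x"
    and "\<And>xs. length xs = n \<Longrightarrow> F xs \<le> G xs"
  shows "wsum A m n F \<le> wsum A m n G"
  using assms(2)
proof (induction n arbitrary: F G)
  case (Suc n)
  then show ?case
    by (auto intro!: sum_mono mult_left_mono assms(1) Suc.IH)
qed simp

lemma wsum_sum: "wsum A m n (\<lambda>xs. \<Sum>i\<in>I. F i xs) = (\<Sum>i\<in>I. wsum A m n (F i))"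
proof (induction n arbitrary: F)
  case (Suc n)
  show ?case
    by (simp add: Suc.IH sum_distrib_left) (rule sum.swap)
qed simp

lemma wsum_add: "wsum A m n (\<lambda>xs. F xs + G xs) = wsum A m n F + wsum A m n G"
  by (induction n arbitrary: F G) (simp_all add: distrib_left sum.distrib)

lemma wsum_cmult: "wsum A m n (\<lambda>xs. c * F xs) = c * wsum A m n F"
  by (induction n arbitrary: F) (simp_all add: sum_distrib_left mult.left_commute)

lemma wsum_const:
  assumes "sum m A = 1"
  shows "wsum A m n (\<lambda>_. c) = c"
  using assms by (induction n) (simp_all flip: sum_distrib_right)

text \<open>For independent entries with a common law, the \<open>n\<close>-th entry is independent
  of the list formed by the others. The bound \<open>n \<le> N\<close> makes \<open>n\<close> a
  valid index in a list of length \<open>Suc N\<close>.\<close>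

lemma wsum_delete_nth:
  assumes "n \<le> N"
  shows "wsum A m (Suc N) (\<lambda>xs. \<Phi> (xs ! n) (take n xs @ drop (Suc n) xs))
    = (\<Sum>x\<in>A. m x * wsum A m N (\<Phi> x))"
  using assms
proof (induction n arbitrary: N \<Phi>)
  case (Suc n)
  then obtain N' where N: "N = Suc N'" "n \<le> N'" by (cases N) auto
  have "wsum A m (Suc N) (\<lambda>xs. \<Phi> (xs ! Suc n) (take (Suc n) xs @ drop (Suc (Suc n)) xs))
      = (\<Sum>y\<in>A. m y * wsum A m N (\<lambda>xs. \<Phi> (xs ! n) (y # take n xs @ drop (Suc n) xs)))"
    by simp
  also have "\<dots> = (\<Sum>y\<in>A. m y * (\<Sum>x\<in>A. m x * wsum A m N' (\<lambda>xs. \<Phi> x (y # xs))))"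
    unfolding N(1) using Suc.IH[OF N(2), of "\<lambda>x xs. \<Phi> x (_ # xs)"] by simp
  also have "\<dots> = (\<Sum>x\<in>A. \<Sum>y\<in>A. m y * (m x * wsum A m N' (\<lambda>xs. \<Phi> x (y # xs))))"
    by (simp only: sum_distrib_left) (rule sum.swap)
  also have "\<dots> = (\<Sum>x\<in>A. m x * wsum A m N (\<Phi> x))"
    by (simp add: N sum_distrib_left mult.left_commute)
  finally show ?case .
qed simp

text \<open>Each of the first \<open>n\<close> entries avoids \<open>Q\<close> independently and
  with the same probability. This is the tail of the geometric waiting time for an entry satisfying
  \<open>Q\<close>.\<close>

lemma wsum_avoid:
  assumes "finite A" "sum m A = 1" "n \<le> N"
  shows "wsum A m N (\<lambda>xs. of_bool (\<forall>x\<in>set (take n xs). \<not> Q x))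
    = (1 - (\<Sum>x | x \<in> A \<and> Q x. m x)) ^ n"
  using assms(3)
proof (induction n arbitrary: N)
  case 0
  then show ?case by (simp add: wsum_const assms)
next
  case (Suc n)
  then obtain N' where N: "N = Suc N'" "n \<le> N'" by (cases N) auto
  let ?a = "\<Sum>x | x \<in> A \<and> Q x. m x"
  have split: "of_bool (\<forall>y\<in>set (take (Suc n) (x # xs)). \<not> Q y)
      = of_bool (\<not> Q x) * (of_bool (\<forall>y\<in>set (take n xs). \<not> Q y) :: real)" for x xs
    by auto
  have "sum m A = ?a + (\<Sum>x | x \<in> A \<and> \<not> Q x. m x)"
    using assms(1) by (subst sum.union_disjoint[symmetric]) (auto intro!: sum.cong)
  moreover have "(\<Sum>x\<in>A. m x * of_bool (\<not> Q x)) = (\<Sum>x | x \<in> A \<and> \<not> Q x. m x)"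
    using assms(1) by (simp add: sum.inter_filter of_bool_def if_distrib cong: if_cong)
  ultimately have "(\<Sum>x\<in>A. m x * of_bool (\<not> Q x)) = 1 - ?a" using assms(2) by simp
  then show ?case
    by (simp only: N wsum.simps split wsum_cmult Suc.IH[OF N(2)] power_Suc)
      (simp flip: mult.assoc sum_distrib_right)
qed

section \<open>The deterministic process and its first effective cut\<close>

lemma foldl_retain_subset: "foldl retain V xs \<subseteq> V"
proof (induction xs arbitrary: V)
  case (Cons T xs)
  have "retain V T \<subseteq> V" by (auto simp: retain_def)
  with Cons[of "retain V T"] show ?case by auto
qed simp

lemma foldl_retain_empty [simp]: "foldl retain {} xs = {}"
  using foldl_retain_subset[of "{}" xs] by simp

lemma foldl_retain_nonempty: "V \<noteq> {} \<Longrightarrow> foldl retain V xs \<noteq> {}"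
proof (induction xs arbitrary: V)
  case (Cons T xs)
  have "retain V T \<noteq> {}" using Cons.prems by (auto simp: retain_def)
  then show ?case using Cons.IH by simp
qed simp

text \<open>The witness \<open>n\<close> is the first cut that contains \<open>z\<close> but not all
  points still present. Induction on \<open>xs\<close>: if the head is such a cut, take
  \<open>n = 0\<close>; otherwise \<open>z\<close> survives the head, and applying the head commutes
  with removing \<open>xs ! n\<close>.\<close>

lemma first_effective_cut:
  assumes "z \<in> V" "foldl retain V xs = {p}" "p \<noteq> z"
  shows "\<exists>n < length xs. z \<in> xs ! n
    \<and> foldl retain (V - xs ! n) (take n xs @ drop (Suc n) xs) = {p}
    \<and> (\<forall>T\<in>set (take n xs). \<not> (p \<in> T \<and> z \<notin> T))"
  using assms
proof (induction xs arbitrary: V)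
  case Nil
  then show ?case by simp
next
  case (Cons T xs)
  show ?case
  proof (cases "z \<in> T \<and> \<not> V \<subseteq> T")
    case True
    then have "foldl retain (V - T) xs = {p}" using Cons.prems by (simp add: retain_def[of V T])
    with True show ?thesis by (intro exI[of _ 0]) simp
  next
    case False
    have z: "z \<in> retain V T" using False Cons.prems by (auto simp: retain_def)
    have r: "foldl retain (retain V T) xs = {p}" using Cons.prems by simp
    obtain n where n: "n < length xs" "z \<in> xs ! n"
        "foldl retain (retain V T - xs ! n) (take n xs @ drop (Suc n) xs) = {p}"
        "\<forall>T\<in>set (take n xs). \<not> (p \<in> T \<and> z \<notin> T)"
      using Cons.IH[OF z r Cons.prems(3)] by (elim exE conjE) (rule that)
    have p: "p \<in> retain V T" using foldl_retain_subset[of "retain V T" xs] r by simp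
    \<comment> \<open>If \<open>V\<close> is not contained in \<open>T\<close> but
      \<open>V - xs ! n\<close> is, the two removals need not commute. Then
      \<open>retain V T - xs ! n\<close> would be empty, contradicting the survival of
      \<open>p\<close>.\<close>
    have "retain V T - xs ! n \<noteq> {}" using n(3) by (metis foldl_retain_empty insert_not_empty)
    then have "retain (V - xs ! n) T = retain V T - xs ! n"
      by (auto simp: retain_def split: if_splits)
    \<comment> \<open>A cut that misses \<open>z \<in> V\<close> is effective, so it would have
      removed \<open>p\<close>.\<close>
    moreover have "\<not> (p \<in> T \<and> z \<notin> T)"
      using p Cons.prems(1) by (auto simp: retain_def split: if_splits)
    ultimately show ?thesis using n by (intro exI[of _ "Suc n"]) simp
  qed
qed

section \<open>Waiting times and the expected value of the survivor\<close>

lemma geometric_tail_le: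
  fixes a :: real
  assumes "0 < a" "a \<le> 1"
  shows "(\<Sum>n\<in>{M..N}. (1 - a) ^ n) \<le> (1 - a) ^ M / a"
proof (cases "M \<le> N")
  case True
  have "(\<Sum>n\<in>{M..N}. (1 - a) ^ n) = ((1 - a) ^ M - (1 - a) ^ Suc N) / a"
    using sum_gp_multiplied[OF True, of "1 - a"] assms by (simp add: field_simps)
  also have "\<dots> \<le> (1 - a) ^ M / a"
    using assms by (intro divide_right_mono) auto
  finally show ?thesis .
qed (use assms in simp)

text \<open>By \<open>1 - a \<le> exp (- a)\<close>, starting the series at \<open>M\<close> costs a
  factor \<open>exp (- x)\<close>. It serves with \<open>x = ln (card U)\<close>, so that a union
  over all points of \<open>U\<close> costs only a constant.\<close>

lemma geometric_tail_exp_le: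
  fixes a x :: real
  assumes "0 < a" "a \<le> 1" "x \<le> a * real M"
  shows "(\<Sum>n\<in>{M..N}. (1 - a) ^ n) \<le> exp (- x) / a"
proof -
  have "(1 - a) ^ M \<le> exp (- a) ^ M"
    using assms exp_ge_add_one_self[of "- a"] by (intro power_mono) auto
  also have "\<dots> = exp (- (a * real M))"
    by (simp flip: exp_of_nat_mult add: mult.commute)
  also have "\<dots> \<le> exp (- x)" using assms by simp
  finally show ?thesis
    using geometric_tail_le[OF assms(1,2), of M N] assms(1)
    by (meson divide_right_mono less_imp_le order_trans)
qed

text \<open>The first factor is the probability that the deleted cut contains \<open>z\<close>. In
  the second, \<open>c * ln (card U)\<close> is the waiting time up to a threshold, \<open>L\<close>
  pays for rounding that threshold to an integer, and the last \<open>c\<close> for the tails beyond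
  it, summed over \<open>U\<close>.\<close>

lemma wsum_survivor_le:
  fixes h :: "'a \<Rightarrow> real" and m :: "'a set \<Rightarrow> real"
  assumes U: "finite U" "z \<in> U"
    and m0: "\<And>S. S \<in> Pow U \<Longrightarrow> 0 \<le> m S" and m1: "sum m (Pow U) = 1"
    and "h z = 0" "\<And>p. 0 \<le> h p" "\<And>p. p \<in> U \<Longrightarrow> h p \<le> L"
    and rate: "\<And>p. p \<in> U \<Longrightarrow> h p > 0 \<Longrightarrow>
      h p \<le> c * (\<Sum>S | S \<in> Pow U \<and> p \<in> S \<and> z \<notin> S. m S)"
    and "0 \<le> c" "0 \<le> L"
  shows "wsum (Pow U) m N (\<lambda>xs. singleton_val h (foldl retain U xs))
    \<le> (\<Sum>S | S \<in> Pow U \<and> z \<in> S. m S) * (c * ln (card U) + L + c)"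
proof -
  define \<alpha> where "\<alpha> p = (\<Sum>S | S \<in> Pow U \<and> p \<in> S \<and> z \<notin> S. m S)" for p
  \<comment> \<open>From \<open>M p\<close> on, when \<open>0 < \<alpha> p\<close>, the probability
    \<open>(1 - \<alpha> p) ^ n\<close> of no cut containing \<open>p\<close> but not
    \<open>z\<close> is at most \<open>1 / card U\<close>.\<close>
  define M where "M p = nat \<lceil>ln (card U) / \<alpha> p\<rceil>" for p
  define alive where "alive p n ws \<longleftrightarrow> (\<forall>T\<in>set (take n ws). \<not> (p \<in> T \<and> z \<notin> T))" for p n ws
  \<comment> \<open>Contribution of the event that \<open>S\<close> is the first effective cut
    containing \<open>z\<close>, at step \<open>n\<close>, with \<open>ws\<close> the sequence left
    after deleting it.\<close>
  define \<Phi> where "\<Phi> n S ws = of_bool (z \<in> S) *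
      singleton_val (\<lambda>p. h p * of_bool (alive p n ws)) (foldl retain (U - S) ws)" for n S ws
  have k: "card U \<ge> 1" using U by (simp add: Suc_le_eq card_gt_0_iff) auto
  have sv0: "0 \<le> singleton_val g V" if "\<And>p. 0 \<le> g p" for g and V :: "'a set"
    using that by (simp add: singleton_val_def)
  have \<Phi>0: "0 \<le> \<Phi> n S ws" for n S ws
    unfolding \<Phi>_def using assms(6) by (intro mult_nonneg_nonneg sv0) auto
  have \<alpha>1: "\<alpha> p \<le> 1" for p
    unfolding \<alpha>_def m1[symmetric] using m0 U by (intro sum_mono2) auto
  have \<alpha>0: "0 < \<alpha> p" "h p \<le> c * \<alpha> p" if "p \<in> U" "0 < h p" for p
  proof -
    show *: "h p \<le> c * \<alpha> p" using rate[OF that] by (simp add: \<alpha>_def)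
    have "0 \<le> \<alpha> p" unfolding \<alpha>_def by (intro sum_nonneg m0) auto
    then show "0 < \<alpha> p" using * that(2) by (cases "\<alpha> p = 0") auto
  qed
  have hM: "h p * real (M p) \<le> c * ln (card U) + L" if "p \<in> U" for p
  proof (cases "0 < h p")
    case True
    have "0 \<le> ln (real (card U)) / \<alpha> p" using \<alpha>0(1)[OF that True] k by simp
    then have "real (M p) \<le> ln (card U) / \<alpha> p + 1" unfolding M_def by linarith
    then have "h p * real (M p) \<le> h p * (ln (card U) / \<alpha> p + 1)"
      using True by (intro mult_left_mono) auto
    also have "\<dots> = h p / \<alpha> p * ln (card U) + h p" by (simp add: field_simps)
    also have "\<dots> \<le> c * ln (card U) + L"
      using \<alpha>0[OF that True] k assms(7)[OF that]
      by (intro add_mono mult_right_mono) (auto simp: field_simps)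
    finally show ?thesis .
  next
    case False
    then have "h p = 0" using assms(6)[of p] by simp
    then show ?thesis using k assms(9,10) by simp
  qed
  have tail: "h p * (\<Sum>n\<in>{M p..N'}. (1 - \<alpha> p) ^ n) \<le> c / card U" if "p \<in> U" for p N'
  proof (cases "0 < h p")
    case True
    note a = \<alpha>0[OF that True]
    have "ln (card U) \<le> \<alpha> p * real (M p)"
    proof -
      have "ln (card U) / \<alpha> p \<le> real (M p)" unfolding M_def by linarith
      then show ?thesis using a by (simp add: field_simps)
    qed
    then have "(\<Sum>n\<in>{M p..N'}. (1 - \<alpha> p) ^ n) \<le> exp (- ln (card U)) / \<alpha> p"
      using a \<alpha>1 by (intro geometric_tail_exp_le) auto
    also have "\<dots> = 1 / card U / \<alpha> p" using k by (simp add: exp_minus field_simps)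
    finally have "h p * (\<Sum>n\<in>{M p..N'}. (1 - \<alpha> p) ^ n) \<le> h p * (1 / card U / \<alpha> p)"
      using True by (intro mult_left_mono) auto
    also have "\<dots> = h p / \<alpha> p * (1 / card U)" by simp
    also have "\<dots> \<le> c * (1 / card U)" using a by (intro mult_right_mono) (auto simp: field_simps)
    finally show ?thesis by simp
  next
    case False
    then have "h p = 0" using assms(6)[of p] by simp
    then show ?thesis using assms(9) by simp
  qed
  have fixedS: "(\<Sum>n\<le>N'. wsum (Pow U) m N' (\<Phi> n S)) \<le> c * ln (card U) + L + c" for S N'
  proof -
    \<comment> \<open>The output \<open>q\<close> depends on \<open>ws\<close>. Steps before
      \<open>M q\<close> are bounded trivially; beyond it the term of \<open>q\<close> is enlarged
      to a sum over all of \<open>U\<close>, whose expectation involves no output. Hence no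
      independence between output and waiting times is used.\<close>
    have "(\<Sum>n\<le>N'. \<Phi> n S ws) \<le> (c * ln (card U) + L)
        + (\<Sum>p\<in>U. \<Sum>n\<in>{M p..N'}. h p * of_bool (alive p n ws))" (is "_ \<le> ?C + ?T") for ws
    proof -
      have C: "0 \<le> ?C" using k assms(9,10) by simp
      have T: "0 \<le> ?T" using assms(6) by (intro sum_nonneg) auto
      show ?thesis
      proof (cases "z \<in> S \<and> is_singleton (foldl retain (U - S) ws)")
        case True
        then obtain q where q: "foldl retain (U - S) ws = {q}" by (auto elim: is_singletonE)
        then have qU: "q \<in> U" using foldl_retain_subset[of "U - S" ws] by auto
        have "(\<Sum>n\<le>N'. \<Phi> n S ws) = (\<Sum>n\<le>N'. h q * of_bool (alive q n ws))"
          using True by (simp add: \<Phi>_def q)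
        also have "\<dots> \<le> (\<Sum>n\<in>{..<M q} \<union> {M q..N'}. h q * of_bool (alive q n ws))"
          using assms(6) by (intro sum_mono2) auto
        also have "\<dots> = (\<Sum>n<M q. h q * of_bool (alive q n ws))
            + (\<Sum>n\<in>{M q..N'}. h q * of_bool (alive q n ws))"
          by (intro sum.union_disjoint) auto
        also have "\<dots> \<le> ?C + ?T"
        proof (rule add_mono)
          have "(\<Sum>n<M q. h q * of_bool (alive q n ws)) \<le> (\<Sum>n<M q. h q)"
            using assms(6) by (intro sum_mono) auto
          also have "\<dots> = h q * real (M q)" by simp
          finally show "(\<Sum>n<M q. h q * of_bool (alive q n ws)) \<le> ?C"
            using hM[OF qU] by linarith
          show "(\<Sum>n\<in>{M q..N'}. h q * of_bool (alive q n ws)) \<le> ?T"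
            using U(1) qU assms(6)
            by (intro member_le_sum[of q U "\<lambda>p. \<Sum>n\<in>{M p..N'}. h p * of_bool (alive p n ws)"])
              (auto intro!: sum_nonneg)
        qed
        finally show ?thesis .
      next
        case False
        then have "\<Phi> n S ws = 0" for n by (auto simp: \<Phi>_def singleton_val_def)
        then show ?thesis using C T by simp
      qed
    qed
    then have "(\<Sum>n\<le>N'. wsum (Pow U) m N' (\<Phi> n S)) \<le> wsum (Pow U) m N'
        (\<lambda>ws. (c * ln (card U) + L) + (\<Sum>p\<in>U. \<Sum>n\<in>{M p..N'}. h p * of_bool (alive p n ws)))"
      unfolding wsum_sum[symmetric] by (intro wsum_mono m0)
    also have "\<dots> = (c * ln (card U) + L) + (\<Sum>p\<in>U. h p * (\<Sum>n\<in>{M p..N'}. (1 - \<alpha> p) ^ n))"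
    proof -
      have "wsum (Pow U) m N' (\<lambda>ws. of_bool (alive p n ws)) = (1 - \<alpha> p) ^ n"
        if "n \<le> N'" for p n
        unfolding alive_def \<alpha>_def using U m1 that by (intro wsum_avoid) auto
      then show ?thesis
        by (simp only: wsum_add wsum_const[OF m1] wsum_sum wsum_cmult sum_distrib_left)
          (intro arg_cong2[of _ _ _ _ plus] sum.cong refl, simp)
    qed
    also have "\<dots> \<le> (c * ln (card U) + L) + (\<Sum>p\<in>U. c / card U)"
      by (intro add_left_mono sum_mono tail)
    also have "\<dots> = c * ln (card U) + L + c" using k by simp
    finally show ?thesis .
  qed
  \<comment> \<open>The first effective cut supplies one summand equal to the left side, and the
    others are nonnegative. If \<open>z\<close> is the output, or no single point is left, the left
    side is 0.\<close>
  have le: "singleton_val h (foldl retain U xs)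
      \<le> (\<Sum>n<length xs. \<Phi> n (xs ! n) (take n xs @ drop (Suc n) xs))" (is "_ \<le> sum ?g _") for xs
  proof (cases "\<exists>p. p \<noteq> z \<and> foldl retain U xs = {p}")
    case True
    then obtain p where p: "p \<noteq> z" "foldl retain U xs = {p}" by blast
    obtain n where n: "n < length xs" "z \<in> xs ! n"
        "foldl retain (U - xs ! n) (take n xs @ drop (Suc n) xs) = {p}"
        "\<forall>T\<in>set (take n xs). \<not> (p \<in> T \<and> z \<notin> T)"
      using first_effective_cut[OF U(2) p(2) p(1)] by (elim exE conjE) (rule that)
    have "singleton_val h (foldl retain U xs) = ?g n"
      using n by (simp add: \<Phi>_def p alive_def)
    also have "\<dots> \<le> sum ?g {..<length xs}"
      using n \<Phi>0 by (intro member_le_sum) auto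
    finally show ?thesis .
  next
    case False
    then have "singleton_val h (foldl retain U xs) = 0"
      using assms(5) by (auto simp: singleton_val_def is_singleton_def)
    then show ?thesis using \<Phi>0 by (simp add: sum_nonneg)
  qed
  show ?thesis
  \<comment> \<open>Deleting an entry requires a nonempty list; for \<open>N = 0\<close> the sum in
    \<open>le\<close> is empty.\<close>
  proof (cases N)
    case 0
    have "0 \<le> (\<Sum>S | S \<in> Pow U \<and> z \<in> S. m S) * (c * ln (card U) + L + c)"
      using k assms(9,10) by (intro mult_nonneg_nonneg sum_nonneg m0) auto
    then show ?thesis using le[of "[]"] 0 by simp
  next
    case (Suc N')
    have "wsum (Pow U) m N (\<lambda>xs. singleton_val h (foldl retain U xs))
        \<le> wsum (Pow U) m N (\<lambda>xs. \<Sum>n\<le>N'. \<Phi> n (xs ! n) (take n xs @ drop (Suc n) xs))"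
    proof (intro wsum_mono m0)
      fix xs :: "'a set list" assume "length xs = N"
      then have "{..<length xs} = {..N'}" using Suc by auto
      then show "singleton_val h (foldl retain U xs)
          \<le> (\<Sum>n\<le>N'. \<Phi> n (xs ! n) (take n xs @ drop (Suc n) xs))"
        using le[of xs] by (simp only:)
    qed
    also have "\<dots> = (\<Sum>n\<le>N'. \<Sum>S\<in>Pow U. m S * wsum (Pow U) m N' (\<Phi> n S))"
      unfolding Suc wsum_sum by (intro sum.cong wsum_delete_nth) auto
    also have "\<dots> = (\<Sum>S\<in>Pow U. m S * (\<Sum>n\<le>N'. wsum (Pow U) m N' (\<Phi> n S)))"
      by (simp only: sum_distrib_left) (rule sum.swap)
    also have "\<dots> = (\<Sum>S | S \<in> Pow U \<and> z \<in> S. m S * (\<Sum>n\<le>N'. wsum (Pow U) m N' (\<Phi> n S)))"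
    proof (rule sum.mono_neutral_right)
      have "\<Phi> n S = (\<lambda>_. 0)" if "z \<notin> S" for n S using that by (auto simp: \<Phi>_def)
      then show "\<forall>S\<in>Pow U - {S. S \<in> Pow U \<and> z \<in> S}.
          m S * (\<Sum>n\<le>N'. wsum (Pow U) m N' (\<Phi> n S)) = 0"
        by (simp add: wsum_const[OF m1])
    qed (use U in auto)
    also have "\<dots> \<le> (\<Sum>S | S \<in> Pow U \<and> z \<in> S. m S * (c * ln (card U) + L + c))"
      by (intro sum_mono mult_left_mono fixedS m0) auto
    finally show ?thesis by (simp only: sum_distrib_right)
  qed
qed

section \<open>From the tree of regions to the set process\<close>

definition cut_set :: "(nat \<Rightarrow> real) set \<Rightarrow> nat \<times> real \<Rightarrow> (nat \<Rightarrow> real) set" where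
  "cut_set U c = {p \<in> U. (p (fst c) \<le> snd c) \<noteq> (0 \<le> snd c)}"

lemma separates_iff:
  "separates U c B \<longleftrightarrow> (U \<inter> B) \<inter> cut_set U c \<noteq> {} \<and> \<not> U \<inter> B \<subseteq> cut_set U c"
proof (cases "0 \<le> snd c")
  case True
  then show ?thesis by (auto simp: separates_def cut_set_def) force+
next
  case False
  then show ?thesis by (auto simp: separates_def cut_set_def) force+
qed

text \<open>A leaf is split exactly when the cut set meets its points without containing all of
  them. In the remaining cases \<open>retain\<close> changes nothing either, so both evolve alike.
  The invariant covers every leaf containing the origin, so it also serves for uniqueness of the
  output.\<close>

lemma leaf_of_origin:
  assumes "U \<noteq> {}"
  shows "(\<exists>B\<in>leaves U \<omega> n. (\<lambda>_. 0) \<in> B) \<and>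
    (\<forall>B\<in>leaves U \<omega> n. (\<lambda>_. 0) \<in> B \<longrightarrow>
      U \<inter> B = foldl retain U (map (cut_set U) (stake n \<omega>)))"
proof (induction n)
  case (Suc n)
  let ?V = "foldl retain U (map (cut_set U) (stake n \<omega>))"
  let ?c = "\<omega> !! n"
  have sep: "separates U ?c B \<longleftrightarrow> ?V \<inter> cut_set U ?c \<noteq> {} \<and> \<not> ?V \<subseteq> cut_set U ?c"
    if "U \<inter> B = ?V" for B
    using separates_iff[of U ?c B] that by simp
  have new: "foldl retain U (map (cut_set U) (stake (Suc n) \<omega>)) = retain ?V (cut_set U ?c)"
    by (simp add: stake_Suc del: stake.simps)
  show ?case
  proof (intro conjI ballI impI)
    obtain B where B: "B \<in> leaves U \<omega> n" "(\<lambda>_. 0) \<in> B" using Suc by blast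
    define B' where "B' = (if separates U ?c B
      then if 0 \<le> snd ?c then B \<inter> {x. x (fst ?c) \<le> snd ?c} else B \<inter> {x. x (fst ?c) > snd ?c}
      else B)"
    have "B' \<in> leaves U \<omega> (Suc n)"
      unfolding leaves.simps split_leaves_def B'_def by (rule UN_I[OF B(1)]) simp
    moreover have "(\<lambda>_. 0) \<in> B'" using B(2) by (simp add: B'_def)
    ultimately show "\<exists>B\<in>leaves U \<omega> (Suc n). (\<lambda>_. 0) \<in> B" by blast
  next
    fix B' assume "B' \<in> leaves U \<omega> (Suc n)" and z: "(\<lambda>_. 0) \<in> B'"
    then obtain B where B: "B \<in> leaves U \<omega> n"
      and B': "B' \<in> (if separates U ?c B then {B \<inter> {x. x (fst ?c) \<le> snd ?c}, B \<inter> {x. x (fst ?c) > snd ?c}} else {B})"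
      by (auto simp: split_leaves_def)
    have "(\<lambda>_. 0) \<in> B" using B' z by (auto split: if_splits)
    then have UB: "U \<inter> B = ?V" using Suc B by blast
    show "U \<inter> B' = foldl retain U (map (cut_set U) (stake (Suc n) \<omega>))"
    proof (cases "separates U ?c B")
      case True
      have "U \<inter> B' = ?V - cut_set U ?c"
        using B' True z UB by (auto simp: cut_set_def)
      then show ?thesis using True sep[OF UB] by (simp only: new) (simp add: retain_def)
    next
      case False
      then have "B' = B" using B' by simp
      moreover have "retain ?V (cut_set U ?c) = ?V"
        using False sep[OF UB] by (auto simp: retain_def)
      ultimately show ?thesis using UB new by simp
    qed
  qed
qed simp

text \<open>Runs that never finish output the origin, so no termination argument is needed.\<close>

lemma l1norm_rt_output_le:
  assumes "finite U" "U \<noteq> {}"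
  shows "\<exists>n. l1norm d (rt_output U \<omega>)
    \<le> singleton_val (l1norm d) (foldl retain U (map (cut_set U) (stake n \<omega>)))"
proof (cases "\<exists>n. finished U (leaves U \<omega> n)")
  case True
  define n where "n = (LEAST n. finished U (leaves U \<omega> n))"
  let ?V = "foldl retain U (map (cut_set U) (stake n \<omega>))"
  have fin: "finished U (leaves U \<omega> n)" unfolding n_def using True by (metis LeastI)
  obtain B where B: "B \<in> leaves U \<omega> n" "(\<lambda>_. 0) \<in> B" "U \<inter> B = ?V"
    using leaf_of_origin[OF assms(2), of \<omega> n] by blast
  have "card ?V \<le> 1"
    using bspec[OF fin[unfolded finished_def] B(1)] unfolding B(3) .
  moreover have "?V \<noteq> {}" "finite ?V"
    by (rule foldl_retain_nonempty[OF assms(2)], rule finite_subset[OF foldl_retain_subset assms(1)])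
  ultimately have "card ?V = 1" by (simp add: le_antisym Suc_leI card_gt_0_iff)
  then obtain p where p: "?V = {p}" by (auto simp: card_1_singleton_iff)
  have "rt_output U \<omega> = (THE p. p \<in> U \<and> (\<exists>B\<in>leaves U \<omega> n. (\<lambda>_. 0) \<in> B \<and> p \<in> B))"
    using True by (simp add: rt_output_def n_def)
  also have "\<dots> = p"
  proof (rule the_equality)
    show "p \<in> U \<and> (\<exists>B\<in>leaves U \<omega> n. (\<lambda>_. 0) \<in> B \<and> p \<in> B)" using B p by blast
    show "q = p" if "q \<in> U \<and> (\<exists>B\<in>leaves U \<omega> n. (\<lambda>_. 0) \<in> B \<and> q \<in> B)" for q
      using that leaf_of_origin[OF assms(2), of \<omega> n] p by blast
  qed
  finally show ?thesis using p by (intro exI[of _ n]) simp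
next
  case False
  then have "l1norm d (rt_output U \<omega>) = 0" by (simp add: rt_output_def l1norm_def)
  then show ?thesis by (simp add: singleton_val_def l1norm_def sum_nonneg)
qed

section \<open>Transfer from streams of cuts to finite lists\<close>

context prob_space
begin

lemma measurable_map_stake:
  assumes "finite A" and f: "f \<in> M \<rightarrow>\<^sub>M count_space A"
  shows "(\<lambda>\<omega>. map f (stake n \<omega>)) \<in>
    stream_space M \<rightarrow>\<^sub>M count_space {xs. set xs \<subseteq> A \<and> length xs = n}"
proof (subst measurable_count_space_eq2, safe)
  show "finite {xs. set xs \<subseteq> A \<and> length xs = n}" by (rule finite_lists_length_eq[OF assms(1)])
  have nth: "(\<lambda>\<omega>. f (\<omega> !! i)) \<in> stream_space M \<rightarrow>\<^sub>M count_space A" for i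
    by (rule measurable_compose[OF measurable_snth f])
  {
    fix \<omega> a assume "\<omega> \<in> space (stream_space M)" "a \<in> set (map f (stake n \<omega>))"
    then show "a \<in> A"
      using measurable_space[OF nth] by (auto simp: in_set_conv_nth)
  }
  fix xs assume xs: "set xs \<subseteq> A" "n = length xs"
  have "(\<lambda>\<omega>. map f (stake n \<omega>)) -` {xs} \<inter> space (stream_space M)
      = {\<omega>\<in>space (stream_space M). \<forall>i<n. f (\<omega> !! i) = xs ! i}"
    using xs by (auto simp: list_eq_iff_nth_eq)
  also have "\<dots> = {\<omega>\<in>space (stream_space M). \<forall>i\<in>{..<n}. f (\<omega> !! i) = xs ! i}" by auto
  also have "\<dots> \<in> sets (stream_space M)"
  proof (intro sets.sets_Collect_finite_All)
    fix i assume "i \<in> {..<n}"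
    then have "xs ! i \<in> A" using xs by auto
    then have "(\<lambda>\<omega>. f (\<omega> !! i)) -` {xs ! i} \<inter> space (stream_space M) \<in> sets (stream_space M)"
      by (intro measurable_sets[OF nth]) auto
    then show "{\<omega> \<in> space (stream_space M). f (\<omega> !! i) = xs ! i} \<in> sets (stream_space M)"
      by (simp add: vimage_def Int_def conj_commute)
  qed auto
  finally show "(\<lambda>\<omega>. map f (stake (length xs) \<omega>)) -` {xs} \<inter> space (stream_space M) \<in> sets (stream_space M)"
    using xs by simp
qed simp

lemma nn_integral_finite_valued:
  assumes "finite A" and f: "f \<in> M \<rightarrow>\<^sub>M count_space A"
  shows "(\<integral>\<^sup>+x. g (f x) \<partial>M) = (\<Sum>a\<in>A. g a * ennreal (prob (f -` {a} \<inter> space M)))"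
proof -
  have "(\<integral>\<^sup>+x. g (f x) \<partial>M) = (\<integral>\<^sup>+x. (\<Sum>a\<in>A. g a * indicator (f -` {a} \<inter> space M) x) \<partial>M)"
  proof (rule nn_integral_cong)
    fix x assume x: "x \<in> space M"
    then have "f x \<in> A" using measurable_space[OF f] by simp
    have "(\<Sum>a\<in>A. g a * indicator (f -` {a} \<inter> space M) x) = (\<Sum>a\<in>A. if f x = a then g a else 0)"
      using x by (intro sum.cong) (auto simp: indicator_def)
    then show "g (f x) = (\<Sum>a\<in>A. g a * indicator (f -` {a} \<inter> space M) x)"
      using \<open>f x \<in> A\<close> assms(1) by simp
  qed
  also have "\<dots> = (\<Sum>a\<in>A. \<integral>\<^sup>+x. g a * indicator (f -` {a} \<inter> space M) x \<partial>M)"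
    by (intro nn_integral_sum borel_measurable_times_ennreal borel_measurable_indicator
        measurable_sets[OF f]) auto
  also have "\<dots> = (\<Sum>a\<in>A. g a * ennreal (prob (f -` {a} \<inter> space M)))"
    by (intro sum.cong refl, subst nn_integral_cmult_indicator)
      (auto intro!: measurable_sets[OF f] simp: emeasure_eq_measure)
  finally show ?thesis .
qed

lemma prob_finite_valued:
  assumes "finite A" "B \<subseteq> A" and f: "f \<in> M \<rightarrow>\<^sub>M count_space A"
  shows "(\<Sum>a\<in>B. prob (f -` {a} \<inter> space M)) = prob (f -` B \<inter> space M)"
proof -
  have "prob (\<Union>a\<in>B. f -` {a} \<inter> space M) = (\<Sum>a\<in>B. prob (f -` {a} \<inter> space M))"
    using assms(1,2) finite_subset
    by (intro finite_measure_finite_Union)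
      (auto intro!: measurable_sets[OF f] simp: disjoint_family_on_def)
  moreover have "(\<Union>a\<in>B. f -` {a} \<inter> space M) = f -` B \<inter> space M" by auto
  ultimately show ?thesis by simp
qed

text \<open>Splitting off the head of the stream matches the recursion of \<open>wsum\<close>, whose
  weights are the law of \<open>f\<close>.\<close>

lemma nn_integral_map_stake:
  assumes "finite A" and f: "f \<in> M \<rightarrow>\<^sub>M count_space A" and "\<And>xs. 0 \<le> F xs"
  shows "(\<integral>\<^sup>+\<omega>. ennreal (F (map f (stake n \<omega>))) \<partial>stream_space M)
    = ennreal (wsum A (\<lambda>a. prob (f -` {a} \<inter> space M)) n F)"
  using assms(3)
proof (induction n arbitrary: F)
  case 0
  interpret S: prob_space "stream_space M" by (rule prob_space_stream_space)
  show ?case by (simp add: S.emeasure_space_1)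
next
  case (Suc n)
  let ?m = "\<lambda>a. prob (f -` {a} \<inter> space M)"
  have "(\<integral>\<^sup>+\<omega>. ennreal (F (map f (stake (Suc n) \<omega>))) \<partial>stream_space M)
      = (\<integral>\<^sup>+x. (\<integral>\<^sup>+\<omega>. ennreal (F (map f (stake (Suc n) (x ## \<omega>)))) \<partial>stream_space M) \<partial>M)"
    by (intro nn_integral_stream_space measurable_compose[OF measurable_map_stake[OF assms(1) f]])
      simp
  also have "\<dots> = (\<integral>\<^sup>+x. ennreal (wsum A ?m n (\<lambda>xs. F (f x # xs))) \<partial>M)"
    using Suc.IH[of "\<lambda>xs. F (_ # xs)"] Suc.prems by simp
  also have "\<dots> = (\<Sum>a\<in>A. ennreal (wsum A ?m n (\<lambda>xs. F (a # xs))) * ennreal (?m a))"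
    by (rule nn_integral_finite_valued[OF assms(1) f])
  also have "\<dots> = ennreal (wsum A ?m (Suc n) F)"
    using Suc.prems by (simp add: ennreal_mult wsum_nonneg sum_nonneg mult.commute flip: sum_ennreal)
  finally show ?case .
qed

end

section \<open>The law of the cut set\<close>

lemma measurable_cut_set:
  assumes "finite U"
  shows "cut_set U \<in> cut_dist d a b \<rightarrow>\<^sub>M count_space (Pow U)"
  unfolding measurable_count_space_eq2[OF finite_Pow_iff[THEN iffD2, OF assms]]
proof (intro conjI ballI)
  fix S assume "S \<in> Pow U"
  have eq: "cut_set U c = S \<longleftrightarrow> (\<forall>p\<in>U. (p \<in> S) = ((p (fst c) \<le> snd c) \<noteq> (0 \<le> snd c)))" for c
  proof -
    have "cut_set U c = S \<longleftrightarrow> (\<forall>p\<in>U. p \<in> S \<longleftrightarrow> p \<in> cut_set U c)"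
      using \<open>S \<in> Pow U\<close> by (auto simp only: cut_set_def Pow_iff)
    then show ?thesis by (simp add: cut_set_def)
  qed
  have "cut_set U -` {S} \<inter> space (cut_dist d a b)
      = {c\<in>space (cut_dist d a b). \<forall>p\<in>U. (p \<in> S) = ((p (fst c) \<le> snd c) \<noteq> (0 \<le> snd c))}"
    by (simp only: vimage_def Int_def mem_Collect_eq singleton_iff eq conj_commute)
  also have "\<dots> \<in> sets (cut_dist d a b)"
  proof (rule sets.sets_Collect_finite_All)
    fix p :: "nat \<Rightarrow> real"
    let ?P = "{c \<in> space (cut_dist d a b). p (fst c) \<le> snd c}"
    let ?Q = "{c \<in> space (cut_dist d a b). 0 \<le> snd c}"
    have p: "p \<in> borel_measurable (uniform_count_measure {..<d})"
      by (auto simp: measurable_def space_uniform_count_measure sets_uniform_count_measure)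
    have 1: "(\<lambda>c. p (fst c)) \<in> borel_measurable (cut_dist d a b)"
      unfolding cut_dist_def
      by (rule measurable_compose[of fst _ "uniform_count_measure {..<d}" p, OF measurable_fst p])
    have 2: "snd \<in> borel_measurable (cut_dist d a b)"
      unfolding cut_dist_def by measurable
    have "?P \<in> sets (cut_dist d a b)" "?Q \<in> sets (cut_dist d a b)"
      using borel_measurable_le[OF 1 2] borel_measurable_le[OF borel_measurable_const[of 0] 2] by blast+
    then have "(?P - ?Q) \<union> (?Q - ?P) \<in> sets (cut_dist d a b)"
        "space (cut_dist d a b) - ((?P - ?Q) \<union> (?Q - ?P)) \<in> sets (cut_dist d a b)"
      by blast+
    moreover have "{c \<in> space (cut_dist d a b). (p \<in> S) = ((p (fst c) \<le> snd c) \<noteq> (0 \<le> snd c))}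
        = (if p \<in> S then (?P - ?Q) \<union> (?Q - ?P)
          else space (cut_dist d a b) - ((?P - ?Q) \<union> (?Q - ?P)))"
      by auto
    ultimately show "{c \<in> space (cut_dist d a b). (p \<in> S) = ((p (fst c) \<le> snd c) \<noteq> (0 \<le> snd c))}
        \<in> sets (cut_dist d a b)"
      by simp
  qed (rule assms)
  finally show "cut_set U -` {S} \<inter> space (cut_dist d a b) \<in> sets (cut_dist d a b)" .
qed (auto simp: cut_set_def)

lemma prob_space_uniform_Icc:
  assumes "a < (b :: real)"
  shows "prob_space (uniform_measure lborel {a..b})"
  using assms by (intro prob_space_uniform_measure) auto

lemma prob_space_cut_dist:
  assumes "0 < d" "a < b"
  shows "prob_space (cut_dist d a b)"
  unfolding cut_dist_def using assms
  by (intro prob_space_pair prob_space_uniform_Icc prob_space_uniform_count_measure) auto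

text \<open>For a fixed coordinate \<open>i\<close>, the thresholds separating \<open>p\<close> from
  the origin form a half-open interval between \<open>p i\<close> and 0. It lies in the box and has
  length \<open>\<bar>p i\<bar>\<close>; averaging over \<open>i\<close> produces the l1
  norm.\<close>

lemma measure_cut_set:
  assumes "0 < d" "a < b" "finite U" "p \<in> U" "a \<le> 0" "0 \<le> b" "\<forall>i<d. a \<le> p i \<and> p i \<le> b"
  shows "measure (cut_dist d a b) (cut_set U -` {S \<in> Pow U. p \<in> S} \<inter> space (cut_dist d a b))
    = l1norm d p / (real d * (b - a))"
proof -
  interpret N: prob_space "uniform_measure lborel {a..b}" by (rule prob_space_uniform_Icc) fact
  let ?X = "cut_set U -` {S \<in> Pow U. p \<in> S} \<inter> space (cut_dist d a b)"
  have X: "?X \<in> sets (cut_dist d a b)"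
    by (rule measurable_sets[OF measurable_cut_set[OF assms(3)]]) auto
  have slice: "emeasure (uniform_measure lborel {a..b}) (Pair i -` ?X)
      = ennreal (\<bar>p i\<bar> / (b - a))" if "i < d" for i
  proof -
    have "Pair i -` ?X = {min (p i) 0 ..< max (p i) 0}"
      using assms(4) that
      by (auto simp: cut_set_def cut_dist_def space_pair_measure space_uniform_count_measure)
    moreover have "{a..b} \<inter> {min (p i) 0 ..< max (p i) 0} = {min (p i) 0 ..< max (p i) 0}"
    proof -
      have "a \<le> p i" "p i \<le> b" using assms(7) that by auto
      then show ?thesis using assms(5,6) by (auto simp: min_def max_def split: if_splits)
    qed
    ultimately show ?thesis
      using assms(2) by (simp add: divide_ennreal)
  qed
  have "emeasure (cut_dist d a b) ?X
      = (\<integral>\<^sup>+i. emeasure (uniform_measure lborel {a..b}) (Pair i -` ?X) \<partial>uniform_count_measure {..<d})"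
    using X unfolding cut_dist_def by (rule N.emeasure_pair_measure_alt)
  also have "\<dots> = (\<Sum>i<d. ennreal (1 / real d) * emeasure (uniform_measure lborel {a..b}) (Pair i -` ?X))"
    unfolding uniform_count_measure_def by (simp add: nn_integral_point_measure_finite)
  also have "\<dots> = (\<Sum>i<d. ennreal (1 / real d * (\<bar>p i\<bar> / (b - a))))"
    by (intro sum.cong refl, subst slice) (simp_all flip: ennreal_mult')
  also have "\<dots> = ennreal (\<Sum>i<d. 1 / real d * (\<bar>p i\<bar> / (b - a)))"
    using assms(1,2) by (intro sum_ennreal) auto
  also have "(\<Sum>i<d. 1 / real d * (\<bar>p i\<bar> / (b - a))) = l1norm d p / (real d * (b - a))"
    by (simp add: l1norm_def sum_divide_distrib)
  finally show ?thesis
    using assms(2) by (simp add: measure_def l1norm_def sum_nonneg)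
qed

section \<open>The quantitative bound and the choice of the cutoff\<close>

text \<open>Outputs of norm at most \<open>1 + s\<close> contribute at most \<open>1 + s\<close>.
  Larger ones fall under \<open>wsum_survivor_le\<close> with \<open>c = (1 + 1 / s) * w\<close> and
  \<open>L = w\<close>; a cut contains \<open>z\<close> with probability \<open>1 / w\<close>, so
  \<open>w\<close> cancels.\<close>

lemma rt_f_le:
  assumes U: "finite U" "z \<in> U" "l1norm d z = 1" "\<forall>p\<in>U. \<forall>i<d. a \<le> p i \<and> p i \<le> b"
    and ab: "a \<le> 0" "0 \<le> b" and "0 < s"
  shows "rt_f d a b U \<le> (1 + s) + ((1 + 1 / s) * (ln (card U) + 1) + 1)"
proof -
  have d: "0 < d" using U(3) by (cases d) (auto simp: l1norm_def)
  have "a < b"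
  proof (rule ccontr)
    assume "\<not> a < b"
    then have "\<forall>i<d. z i = 0" using U(2,4) ab by force
    then show False using U(3) by (simp add: l1norm_def)
  qed
  interpret prob_space "cut_dist d a b" by (rule prob_space_cut_dist) fact+
  define w where "w = real d * (b - a)"
  have w: "0 < w" using d \<open>a < b\<close> by (simp add: w_def)
  define m where "m S = prob (cut_set U -` {S} \<inter> space (cut_dist d a b))" for S
  define h where "h p = (if 1 + s < l1norm d p then l1norm d p else 0)" for p
  define B where "B = (1 + s) + ((1 + 1 / s) * (ln (card U) + 1) + 1)"
  have finU: "finite (Pow U)" using U by simp
  note mcs = measurable_cut_set[OF U(1), of d a b]
  have m0: "0 \<le> m S" for S by (simp add: m_def)
  have m1: "sum m (Pow U) = 1"
  proof -
    have "cut_set U -` Pow U \<inter> space (cut_dist d a b) = space (cut_dist d a b)"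
      by (auto simp: cut_set_def)
    then show ?thesis
      unfolding m_def using prob_finite_valued[OF finU order_refl mcs] by (simp add: prob_space)
  qed
  have mp: "(\<Sum>S | S \<in> Pow U \<and> p \<in> S. m S) = l1norm d p / w" if "p \<in> U" for p
    unfolding m_def w_def
    using prob_finite_valued[OF finU _ mcs, of "{S \<in> Pow U. p \<in> S}"]
      measure_cut_set[OF d \<open>a < b\<close> U(1) that ab] U(4) that by auto
  \<comment> \<open>The probability \<open>l1norm d p / w\<close> is at most 1; this supplies the
    bound \<open>L = w\<close>.\<close>
  have norm_le: "l1norm d p \<le> w" if "p \<in> U" for p
  proof -
    have "(\<Sum>S | S \<in> Pow U \<and> p \<in> S. m S) \<le> sum m (Pow U)"
      using finU m0 by (intro sum_mono2) auto
    then show ?thesis unfolding mp[OF that] m1 using w by (simp add: pos_divide_le_eq)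
  qed
  have rate: "h p \<le> ((1 + 1 / s) * w) * (\<Sum>S | S \<in> Pow U \<and> p \<in> S \<and> z \<notin> S. m S)"
    if "p \<in> U" "0 < h p" for p
  proof -
    have "(\<Sum>S | S \<in> Pow U \<and> p \<in> S. m S) \<le>
        (\<Sum>S\<in>{S. S \<in> Pow U \<and> p \<in> S \<and> z \<notin> S} \<union> {S. S \<in> Pow U \<and> z \<in> S}. m S)"
      using U(1) m0 by (intro sum_mono2) auto
    also have "\<dots> = (\<Sum>S | S \<in> Pow U \<and> p \<in> S \<and> z \<notin> S. m S) + (\<Sum>S | S \<in> Pow U \<and> z \<in> S. m S)"
      using U(1) by (intro sum.union_disjoint) auto
    finally have *: "(l1norm d p - 1) / w \<le> (\<Sum>S | S \<in> Pow U \<and> p \<in> S \<and> z \<notin> S. m S)"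
      using mp[OF that(1)] mp[OF U(2)] U(3) by (simp add: diff_divide_distrib)
    have "1 + s < l1norm d p" "h p = l1norm d p" using that(2) by (auto simp: h_def split: if_splits)
    \<comment> \<open>\<open>x / (x - 1)\<close> decreases in \<open>x\<close> and equals
      \<open>1 + 1 / s\<close> at \<open>x = 1 + s\<close>.\<close>
    then have "h p \<le> (1 + 1 / s) * (l1norm d p - 1)"
      using \<open>0 < s\<close> by (simp add: field_simps)
    also have "\<dots> = ((1 + 1 / s) * w) * ((l1norm d p - 1) / w)" using w by simp
    also have "\<dots> \<le> ((1 + 1 / s) * w) * (\<Sum>S | S \<in> Pow U \<and> p \<in> S \<and> z \<notin> S. m S)"
      using * w \<open>0 < s\<close> by (intro mult_left_mono) auto
    finally show ?thesis .
  qed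
  let ?V = "\<lambda>n \<omega>. foldl retain U (map (cut_set U) (stake n \<omega>))"
  have bound: "wsum (Pow U) m n (\<lambda>xs. singleton_val (l1norm d) (foldl retain U xs)) \<le> B" for n
  proof -
    have "wsum (Pow U) m n (\<lambda>xs. singleton_val (l1norm d) (foldl retain U xs))
        \<le> wsum (Pow U) m n (\<lambda>xs. (1 + s) + singleton_val h (foldl retain U xs))"
      using \<open>0 < s\<close> m0 by (intro wsum_mono) (auto simp: singleton_val_def h_def)
    also have "\<dots> = (1 + s) + wsum (Pow U) m n (\<lambda>xs. singleton_val h (foldl retain U xs))"
      by (simp only: wsum_add wsum_const[OF m1])
    also have "wsum (Pow U) m n (\<lambda>xs. singleton_val h (foldl retain U xs))
        \<le> (\<Sum>S | S \<in> Pow U \<and> z \<in> S. m S) *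
          ((1 + 1 / s) * w * ln (card U) + w + (1 + 1 / s) * w)"
    proof (rule wsum_survivor_le[OF U(1,2) m0 m1])
      show "h p \<le> w" if "p \<in> U" for p using norm_le[OF that] w by (simp add: h_def)
      show "0 \<le> h p" for p by (simp add: h_def l1norm_def sum_nonneg)
    qed (use rate U(3) \<open>0 < s\<close> w in \<open>auto simp: h_def\<close>)
    also have "\<dots> = (1 + 1 / s) * (ln (card U) + 1) + 1"
      unfolding mp[OF U(2)] U(3) using w by (simp add: field_simps)
    finally show ?thesis by (simp add: B_def)
  qed
  have "(\<integral>\<^sup>+\<omega>. ennreal (l1norm d (rt_output U \<omega>)) \<partial>stream_space (cut_dist d a b))
      \<le> (\<integral>\<^sup>+\<omega>. (SUP n. ennreal (singleton_val (l1norm d) (?V n \<omega>))) \<partial>stream_space (cut_dist d a b))"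
  proof (rule nn_integral_mono)
    fix \<omega>
    have "U \<noteq> {}" using U by auto
    then obtain n where "l1norm d (rt_output U \<omega>) \<le> singleton_val (l1norm d) (?V n \<omega>)"
      using l1norm_rt_output_le[OF U(1)] by blast
    then show "ennreal (l1norm d (rt_output U \<omega>))
        \<le> (SUP n. ennreal (singleton_val (l1norm d) (?V n \<omega>)))"
      by (intro SUP_upper2[of n] ennreal_leI) auto
  qed
  also have "\<dots> = (SUP n. \<integral>\<^sup>+\<omega>. ennreal (singleton_val (l1norm d) (?V n \<omega>)) \<partial>stream_space (cut_dist d a b))"
  proof (rule nn_integral_monotone_convergence_SUP)
    show "(\<lambda>\<omega>. ennreal (singleton_val (l1norm d) (?V n \<omega>))) \<in> borel_measurable (stream_space (cut_dist d a b))"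
      for n
      by (rule measurable_compose[OF measurable_map_stake[OF finU mcs]]) simp
    \<comment> \<open>A singleton is never changed by \<open>retain\<close>, and before that the
      value is 0.\<close>
    show "incseq (\<lambda>n \<omega>. ennreal (singleton_val (l1norm d) (?V n \<omega>)))"
    proof (intro incseq_SucI le_funI ennreal_leI)
      fix n \<omega>
      show "singleton_val (l1norm d) (?V n \<omega>) \<le> singleton_val (l1norm d) (?V (Suc n) \<omega>)"
      proof (cases "is_singleton (?V n \<omega>)")
        case True
        then obtain p where p: "?V n \<omega> = {p}" by (auto elim: is_singletonE)
        have "?V (Suc n) \<omega> = retain {p} (cut_set U (\<omega> !! n))"
          by (simp add: stake_Suc p del: stake.simps)
        then have "?V (Suc n) \<omega> = {p}" by (auto simp: retain_def)
        with p show ?thesis by (simp del: stake.simps)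
      next
        case False
        then show ?thesis
          by (simp add: singleton_val_def[of _ "?V n \<omega>"])
            (simp add: singleton_val_def l1norm_def sum_nonneg)
      qed
    qed
  qed
  also have "\<dots> \<le> ennreal B"
  proof (rule SUP_least)
    fix n
    have "(\<integral>\<^sup>+\<omega>. ennreal (singleton_val (l1norm d) (?V n \<omega>)) \<partial>stream_space (cut_dist d a b))
        = ennreal (wsum (Pow U) m n (\<lambda>xs. singleton_val (l1norm d) (foldl retain U xs)))"
      unfolding m_def
      by (rule nn_integral_map_stake[OF finU mcs])
        (simp add: singleton_val_def l1norm_def sum_nonneg)
    also have "\<dots> \<le> ennreal B" by (rule ennreal_leI[OF bound])
    finally show "(\<integral>\<^sup>+\<omega>. ennreal (singleton_val (l1norm d) (?V n \<omega>)) \<partial>stream_space (cut_dist d a b))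
        \<le> ennreal B" .
  qed
  finally have "(\<integral>\<^sup>+\<omega>. ennreal (l1norm d (rt_output U \<omega>)) \<partial>stream_space (cut_dist d a b)) \<le> ennreal B" .
  \<comment> \<open>A non-integrable function has Bochner integral 0, so passing from the
    nonnegative integral to \<open>rt_f\<close> calls for \<open>0 \<le> B\<close>.\<close>
  moreover have "0 \<le> B"
  proof -
    have "1 \<le> card U" using U by (auto simp: Suc_le_eq card_gt_0_iff)
    then show ?thesis using \<open>0 < s\<close> by (simp add: B_def)
  qed
  ultimately show ?thesis unfolding rt_f_def B_def[symmetric] by (intro integral_real_bounded)
qed

theorem theorem2p3:
  shows "\<exists>\<epsilon> :: nat \<Rightarrow> real. \<epsilon> \<longlonglongrightarrow> 0 \<and>
    (\<forall>k d (U :: (nat \<Rightarrow> real) set) a b.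
       k \<ge> 2 \<longrightarrow> finite U \<longrightarrow> card U = k \<longrightarrow>
       (\<forall>p\<in>U. \<forall>i\<ge>d. p i = 0) \<longrightarrow>
       a \<le> 0 \<longrightarrow> 0 \<le> b \<longrightarrow> (\<forall>p\<in>U. \<forall>i<d. a \<le> p i \<and> p i \<le> b) \<longrightarrow>
       Min (l1norm d ` U) = 1 \<longrightarrow>
       rt_f d a b U \<le> (1 + \<epsilon> k) * ln (real k))"
proof -
  \<comment> \<open>The bound of \<open>rt_f_le\<close> with \<open>x = ln k\<close> and
    \<open>s = sqrt x\<close>: both the cutoff \<open>s\<close> and the loss \<open>x / s\<close>
    are then of order \<open>sqrt x\<close>, hence negligible against \<open>x\<close>. The choice
    of \<epsilon> below makes \<open>(1 + \<epsilon> k) * ln k\<close> equal to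
    \<open>B (ln k)\<close>.\<close>
  define B :: "real \<Rightarrow> real" where "B x = (1 + sqrt x) + ((1 + 1 / sqrt x) * (x + 1) + 1)" for x
  show ?thesis
  proof (intro exI[of _ "\<lambda>k. B (ln (real k)) / ln (real k) - 1"] conjI allI impI)
    have "((\<lambda>x. B x / x - 1) \<longlongrightarrow> 0) at_top"
      unfolding B_def by real_asymp
    moreover have "filterlim (\<lambda>k. ln (real k)) at_top sequentially" by real_asymp
    ultimately show "(\<lambda>k. B (ln (real k)) / ln (real k) - 1) \<longlonglongrightarrow> 0"
      by (rule filterlim_compose)
    fix k d and U :: "(nat \<Rightarrow> real) set" and a b
    assume H: "2 \<le> k" "finite U" "card U = k" "a \<le> 0" "0 \<le> b"
      "\<forall>p\<in>U. \<forall>i<d. a \<le> p i \<and> p i \<le> b" "Min (l1norm d ` U) = 1"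
    have "U \<noteq> {}" using H by auto
    then have "Min (l1norm d ` U) \<in> l1norm d ` U" using H by (intro Min_in) auto
    then obtain z where z: "z \<in> U" "l1norm d z = 1" using H by force
    have "0 < ln (real k)" using H by simp
    then have "rt_f d a b U \<le> B (ln (real k))"
      using rt_f_le[OF H(2) z H(6,4,5), of "sqrt (ln (real k))"] H(3) by (simp add: B_def)
    then show "rt_f d a b U \<le> (1 + (B (ln (real k)) / ln (real k) - 1)) * ln (real k)"
      using \<open>0 < ln (real k)\<close> by simp
  qed
qed

end
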